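(* Let $P$ be a finite poset with a strictly order-preserving rank function $\rho:P\to\mathbb N$. Set $\bar\zeta(x,x)=1$ for all $x\in P$. Choose the values $\bar\zeta(x,z)\in\mathbb C$ arbitrarily for all $x<z$ for which the rank difference $\rho(x,z)$ is odd, and for $x<z$ with $\rho(x,z)$ even let (recursively) $$\bar\zeta(x,z)=-\frac12\sum_{x<y<z}(-1)^{\rho(x,y)}\cdot\bar\zeta(x,y)\cdot\bar\zeta(y,z).$$ Then $(P,\rho,\bar\zeta)$ is an Eulerian quasi-graded poset.
   Context: Write $\rho(x,y)=\rho(y)-\rho(x)$; $\rho$ is strictly order-preserving if $x<y\Rightarrow\rho(x)<\rho(y)$. A quasi-graded poset $(P,\rho,\bar\zeta)$ consists of a finite poset $P$, a strictly order-preserving function $\rho:P\to\mathbb N$, and a complex-valued function $\bar\zeta$ in the incidence algebra of $P$ with $\bar\zeta(x,x)=1$ for all $x\in P$. It is Eulerian if for all $x\le z$ $$\sum_{x\le y\le z}(-1)^{\rho(x,y)}\,\bar\zeta(x,y)\,\bar\zeta(y,z)=\delta_{x,z}.$$ *)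

theory Defs
  imports Complex_Main
begin

text \<open>
  A poset is a carrier set \<open>P\<close> together with its order relation \<open>r\<close>, where
  \<open>(x, y) \<in> r\<close> means \<open>x \<le> y\<close>; \<^const>\<open>partial_order_on\<close> includes \<open>r \<subseteq> P \<times> P\<close>.
\<close>

definition strictly_below :: "'a rel \<Rightarrow> 'a \<Rightarrow> 'a \<Rightarrow> bool" where
  "strictly_below r x y \<longleftrightarrow> (x, y) \<in> r \<and> x \<noteq> y"

definition rank_diff :: "('a \<Rightarrow> nat) \<Rightarrow> 'a \<Rightarrow> 'a \<Rightarrow> int" where
  "rank_diff \<rho> x y = int (\<rho> y) - int (\<rho> x)"

text \<open>
  Elements of the incidence algebra are functions on the pairs \<open>x \<le> y\<close>,
  represented as total functions extended by zero.
\<close>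

definition incidence_algebra :: "'a rel \<Rightarrow> ('a \<Rightarrow> 'a \<Rightarrow> complex) set" where
  "incidence_algebra r = {f. \<forall>x y. (x, y) \<notin> r \<longrightarrow> f x y = 0}"

locale finite_ranked_poset =
  fixes P :: "'a set" and r :: "'a rel" and \<rho> :: "'a \<Rightarrow> nat"
  assumes finite_carrier: "finite P"
    and partial_order: "partial_order_on P r"
    and rank_strict: "strictly_below r x y \<Longrightarrow> \<rho> x < \<rho> y"

locale quasi_graded_poset = finite_ranked_poset P r \<rho>
  for P :: "'a set" and r :: "'a rel" and \<rho> :: "'a \<Rightarrow> nat" +
  fixes \<zeta> :: "'a \<Rightarrow> 'a \<Rightarrow> complex"
  assumes zeta_incidence: "\<zeta> \<in> incidence_algebra r"
    and zeta_refl: "x \<in> P \<Longrightarrow> \<zeta> x x = 1"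

locale eulerian_quasi_graded_poset = quasi_graded_poset P r \<rho> \<zeta>
  for P :: "'a set" and r :: "'a rel" and \<rho> :: "'a \<Rightarrow> nat"
    and \<zeta> :: "'a \<Rightarrow> 'a \<Rightarrow> complex" +
  assumes eulerian: "(x, z) \<in> r \<Longrightarrow>
    (\<Sum>y\<in>{y. (x, y) \<in> r \<and> (y, z) \<in> r}. (-1) powi rank_diff \<rho> x y * \<zeta> x y * \<zeta> y z)
      = (if x = z then 1 else 0)"

text \<open>
  \<open>\<zeta>\<close> is the weighted zeta function obtained from the choice \<open>c\<close> of values on the
  pairs \<open>x < z\<close> of odd rank difference (all other values of \<open>c\<close> are ignored) by the
  recursion for even rank difference.
\<close>

definition is_recursive_zeta ::
  "'a set \<Rightarrow> 'a rel \<Rightarrow> ('a \<Rightarrow> nat) \<Rightarrow> ('a \<Rightarrow> 'a \<Rightarrow> complex) \<Rightarrow> ('a \<Rightarrow> 'a \<Rightarrow> complex) \<Rightarrow> bool" where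
  "is_recursive_zeta P r \<rho> c \<zeta> \<longleftrightarrow>
     \<zeta> \<in> incidence_algebra r \<and>
     (\<forall>x\<in>P. \<zeta> x x = 1) \<and>
     (\<forall>x z. strictly_below r x z \<and> odd (rank_diff \<rho> x z) \<longrightarrow> \<zeta> x z = c x z) \<and>
     (\<forall>x z. strictly_below r x z \<and> even (rank_diff \<rho> x z) \<longrightarrow>
        \<zeta> x z = - (1 / 2) * (\<Sum>y\<in>{y. strictly_below r x y \<and> strictly_below r y z}.
                     (-1) powi rank_diff \<rho> x y * \<zeta> x y * \<zeta> y z))"

end

theory Submission
  imports Defs
begin

text \<open>
  Let \<open>E = (\<sigma> \<zeta>) * \<zeta>\<close>, where \<open>\<sigma> f x y = (-1) ^ \<rho>(x, y) * f x y\<close> is an involutive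
  automorphism of the incidence algebra.  Then \<open>\<zeta> * E = \<zeta> * (\<sigma> \<zeta>) * \<zeta> = (\<sigma> E) * \<zeta>\<close>.
  If \<open>E\<close> is the identity on all proper subintervals of \<open>[x, z]\<close>, comparing both sides at
  \<open>(x, z)\<close> gives \<open>E x z = \<sigma> E x z\<close>, so \<open>E x z = 0\<close> whenever \<open>\<rho>(x, z)\<close> is odd.  For even
  \<open>\<rho>(x, z)\<close> the recursion says precisely that \<open>E x z = 0\<close>.
\<close>

definition convolution ::
  "'a rel \<Rightarrow> ('a \<Rightarrow> 'a \<Rightarrow> complex) \<Rightarrow> ('a \<Rightarrow> 'a \<Rightarrow> complex) \<Rightarrow> 'a \<Rightarrow> 'a \<Rightarrow> complex" where
  "convolution r f g x z = (\<Sum>y\<in>{y. (x, y) \<in> r \<and> (y, z) \<in> r}. f x y * g y z)"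

definition sign_twist ::
  "('a \<Rightarrow> nat) \<Rightarrow> ('a \<Rightarrow> 'a \<Rightarrow> complex) \<Rightarrow> 'a \<Rightarrow> 'a \<Rightarrow> complex" where
  "sign_twist \<rho> f x y = (-1) powi rank_diff \<rho> x y * f x y"

lemma sign_twist_even: "even (rank_diff \<rho> x y) \<Longrightarrow> sign_twist \<rho> f x y = f x y"
  by (simp add: sign_twist_def power_int_minus_left)

lemma sign_twist_odd: "odd (rank_diff \<rho> x y) \<Longrightarrow> sign_twist \<rho> f x y = - f x y"
  by (simp add: sign_twist_def power_int_minus_left)

lemma sign_twist_twist: "sign_twist \<rho> (sign_twist \<rho> f) = f"
proof (intro ext)
  fix x y
  show "sign_twist \<rho> (sign_twist \<rho> f) x y = f x y"
    by (cases "even (rank_diff \<rho> x y)") (simp_all add: sign_twist_even sign_twist_odd)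
qed

text \<open>Rank differences add along \<open>x\<close>, \<open>y\<close>, \<open>z\<close>, so the
  sign of the pair \<open>(x, z)\<close> splits as the product of the signs of \<open>(x, y)\<close>
  and \<open>(y, z)\<close> in every summand.\<close>

lemma sign_twist_convolution:
  "sign_twist \<rho> (convolution r f g) = convolution r (sign_twist \<rho> f) (sign_twist \<rho> g)"
proof (intro ext)
  fix x z
  have "(-1::complex) powi rank_diff \<rho> x z
      = (-1) powi rank_diff \<rho> x y * (-1) powi rank_diff \<rho> y z" for y
    by (subst power_int_add [symmetric]) (auto simp: rank_diff_def)
  then show "sign_twist \<rho> (convolution r f g) x z
      = convolution r (sign_twist \<rho> f) (sign_twist \<rho> g) x z"
    unfolding sign_twist_def convolution_def sum_distrib_left
    by (intro sum.cong) (auto simp: mult_ac)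
qed

context finite_ranked_poset
begin

lemma rel_refl: "x \<in> P \<Longrightarrow> (x, x) \<in> r"
  and rel_trans: "(x, y) \<in> r \<Longrightarrow> (y, z) \<in> r \<Longrightarrow> (x, z) \<in> r"
  and rel_antisym: "(x, y) \<in> r \<Longrightarrow> (y, x) \<in> r \<Longrightarrow> x = y"
  and rel_carrier: "(x, y) \<in> r \<Longrightarrow> x \<in> P \<and> y \<in> P"
  using partial_order
  unfolding partial_order_on_def preorder_on_def refl_on_def antisym_def
  by (auto dest: transD)

lemma finite_interval: "finite {y. (x, y) \<in> r \<and> (y, z) \<in> r}"
  by (rule finite_subset [OF _ finite_carrier]) (auto dest: rel_carrier)

lemma interval_insert_ends:
  assumes "strictly_below r x z"
  shows "{y. (x, y) \<in> r \<and> (y, z) \<in> r}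
    = insert x (insert z {y. strictly_below r x y \<and> strictly_below r y z})"
  using assms rel_carrier rel_refl by (auto simp: strictly_below_def)

text \<open>Separates the two terms that see the whole interval from those that involve only proper
  subintervals, where the recursion and the induction hypothesis apply.\<close>

lemma convolution_ends:
  assumes "strictly_below r x z"
  shows "convolution r f g x z = f x x * g x z + f x z * g z z
    + (\<Sum>y\<in>{y. strictly_below r x y \<and> strictly_below r y z}. f x y * g y z)"
proof -
  have "finite {y. strictly_below r x y \<and> strictly_below r y z}"
    by (rule finite_subset [OF _ finite_interval [of x z]]) (auto simp: strictly_below_def)
  then show ?thesis
    using assms unfolding convolution_def interval_insert_ends [OF assms]
    by (simp add: strictly_below_def)
qed

lemma convolution_refl: "x \<in> P \<Longrightarrow> convolution r f g x x = f x x * g x x"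
proof -
  assume "x \<in> P"
  then have "{y. (x, y) \<in> r \<and> (y, x) \<in> r} = {x}"
    using rel_antisym rel_refl by blast
  then show ?thesis
    by (simp add: convolution_def)
qed

lemma convolution_assoc:
  "convolution r f (convolution r g h) = convolution r (convolution r f g) h"
proof (intro ext)
  fix x z
  let ?I = "\<lambda>x z. {y. (x, y) \<in> r \<and> (y, z) \<in> r}"
  \<comment> \<open>By transitivity the inner interval from \<open>y\<close> to \<open>z\<close> is
    the part of the outer interval above \<open>y\<close>. Both sums then range over one finite set,
    restricted by \<open>(y, w) \<in> r\<close>, and can be exchanged.\<close>
  have "convolution r f (convolution r g h) x z
      = (\<Sum>y\<in>?I x z. \<Sum>w\<in>{w\<in>?I x z. (y, w) \<in> r}. f x y * (g y w * h w z))"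
    unfolding convolution_def sum_distrib_left
    by (intro sum.cong) (auto intro: rel_trans)
  also have "\<dots> = (\<Sum>w\<in>?I x z. \<Sum>y\<in>{y\<in>?I x z. (y, w) \<in> r}. f x y * (g y w * h w z))"
    by (rule sum.swap_restrict) (auto intro: finite_interval)
  also have "\<dots> = convolution r (convolution r f g) h x z"
    unfolding convolution_def sum_distrib_right
    by (intro sum.cong) (auto intro: rel_trans simp: mult_ac)
  finally show "convolution r f (convolution r g h) x z
      = convolution r (convolution r f g) h x z" .
qed

text \<open>The witness for existence. The recursion is well founded because the rank gap of an
  interval strictly exceeds the gaps on both sides of any interior point.\<close>

function recursive_zeta :: "('a \<Rightarrow> 'a \<Rightarrow> complex) \<Rightarrow> 'a \<Rightarrow> 'a \<Rightarrow> complex" where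
  "recursive_zeta c x z =
    (if (x, z) \<notin> r then 0
     else if x = z then 1
     else if odd (rank_diff \<rho> x z) then c x z
     else - (1 / 2) * (\<Sum>y\<in>{y. strictly_below r x y \<and> strictly_below r y z}.
            (-1) powi rank_diff \<rho> x y * recursive_zeta c x y * recursive_zeta c y z))"
  by pat_completeness auto
termination
  by (relation "measure (\<lambda>(c, x, z). \<rho> z - \<rho> x)")
    (auto dest!: rank_strict)

declare recursive_zeta.simps [simp del]

lemma is_recursive_zeta_recursive_zeta: "is_recursive_zeta P r \<rho> c (recursive_zeta c)"
  unfolding is_recursive_zeta_def incidence_algebra_def
proof (intro conjI ballI allI impI CollectI)
  show "recursive_zeta c x y = 0" if "(x, y) \<notin> r" for x y
    using that by (subst recursive_zeta.simps) simp
  show "recursive_zeta c x x = 1" if "x \<in> P" for x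
    using rel_refl [OF that] by (subst recursive_zeta.simps) simp
  show "recursive_zeta c x z = c x z"
    if "strictly_below r x z \<and> odd (rank_diff \<rho> x z)" for x z
    using that by (subst recursive_zeta.simps) (simp add: strictly_below_def)
  show "recursive_zeta c x z = - (1 / 2) *
      (\<Sum>y\<in>{y. strictly_below r x y \<and> strictly_below r y z}.
        (-1) powi rank_diff \<rho> x y * recursive_zeta c x y * recursive_zeta c y z)"
    if "strictly_below r x z \<and> even (rank_diff \<rho> x z)" for x z
    using that by (subst recursive_zeta.simps) (simp add: strictly_below_def)
qed

text \<open>Induction on the rank gap: an even pair is determined by proper subintervals, and every
  other value is prescribed outright.\<close>

lemma is_recursive_zeta_unique:
  assumes "is_recursive_zeta P r \<rho> c \<zeta>"
  shows "\<zeta> = recursive_zeta c"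
proof (intro ext)
  fix x z
  show "\<zeta> x z = recursive_zeta c x z"
  proof (induction "\<rho> z - \<rho> x" arbitrary: x z rule: less_induct)
    case less
    show ?case
    proof (cases "strictly_below r x z \<and> even (rank_diff \<rho> x z)")
      case True
      have "\<zeta> x y = recursive_zeta c x y \<and> \<zeta> y z = recursive_zeta c y z"
        if "strictly_below r x y" "strictly_below r y z" for y
        using rank_strict [OF that(1)] rank_strict [OF that(2)]
        by (auto intro!: less)
      then show ?thesis
        using True assms is_recursive_zeta_recursive_zeta [of c]
        by (simp add: is_recursive_zeta_def)
    next
      case False
      then consider "(x, z) \<notin> r" | "x = z" "x \<in> P"
        | "strictly_below r x z" "odd (rank_diff \<rho> x z)"
        using rel_carrier by (auto simp: strictly_below_def)
      then show ?thesis
        using assms is_recursive_zeta_recursive_zeta [of c]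
        by cases (simp_all add: is_recursive_zeta_def incidence_algebra_def)
    qed
  qed
qed

text \<open>The Eulerian condition in the incidence algebra:
  \<open>sign_twist \<rho> \<zeta>\<close> is a left inverse of \<open>\<zeta>\<close>.\<close>

lemma convolution_twist_zeta:
  assumes \<zeta>: "is_recursive_zeta P r \<rho> c \<zeta>" and "(x, z) \<in> r"
  shows "convolution r (sign_twist \<rho> \<zeta>) \<zeta> x z = (if x = z then 1 else 0)"
  using \<open>(x, z) \<in> r\<close>
proof (induction "\<rho> z - \<rho> x" arbitrary: x z rule: less_induct)
  case less
  define E where "E = convolution r (sign_twist \<rho> \<zeta>) \<zeta>"
  have refl: "\<zeta> y y = 1" "sign_twist \<rho> \<zeta> y y = 1" "E y y = 1" "sign_twist \<rho> E y y = 1"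
    if "y \<in> P" for y
    using \<zeta> that
    by (simp_all add: is_recursive_zeta_def E_def convolution_refl sign_twist_def rank_diff_def)
  have P: "x \<in> P" "z \<in> P"
    using rel_carrier less.prems by auto
  show ?case
  proof (cases "x = z")
    case True
    then show ?thesis using refl P by (simp add: E_def)
  next
    case False
    then have xz: "strictly_below r x z"
      using less.prems by (simp add: strictly_below_def)
    have "E x z = 0"
    proof (cases "even (rank_diff \<rho> x z)")
      case True
      then have "\<zeta> x z = - (1 / 2) *
          (\<Sum>y\<in>{y. strictly_below r x y \<and> strictly_below r y z}. sign_twist \<rho> \<zeta> x y * \<zeta> y z)"
        using \<zeta> xz by (simp add: is_recursive_zeta_def sign_twist_def)
      \<comment> \<open>The sign at \<open>(x, z)\<close> is positive, so each end term equals
        \<open>\<zeta> x z\<close>; together they give \<open>2 * \<zeta> x z\<close>, which cancels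
        the inner sum. This is where the factor 1/2 comes from.\<close>
      then show ?thesis
        using True refl P by (simp add: E_def convolution_ends [OF xz] sign_twist_even)
    next
      case False
      have "E x y = 0 \<and> E y z = 0" if "strictly_below r x y" "strictly_below r y z" for y
        using less.hyps [of y x] less.hyps [of z y] that rank_strict [OF that(1)]
          rank_strict [OF that(2)]
        by (auto simp: E_def strictly_below_def)
      then have inner: "E y z = 0" "sign_twist \<rho> E x y = 0"
        if "strictly_below r x y" "strictly_below r y z" for y
        using that by (auto simp: sign_twist_def)
      \<comment> \<open>Twisting \<open>E\<close> removes the sign from its first factor and puts it
        on its second, so both sides are the triple product of \<open>\<zeta>\<close>,
        \<open>sign_twist \<rho> \<zeta>\<close> and \<open>\<zeta>\<close>.\<close>
      have "convolution r \<zeta> E = convolution r (sign_twist \<rho> E) \<zeta>"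
        by (simp add: E_def sign_twist_convolution sign_twist_twist convolution_assoc)
      then have "convolution r \<zeta> E x z = convolution r (sign_twist \<rho> E) \<zeta> x z"
        by simp
      \<comment> \<open>The inner sums vanish, and each side keeps one end term
        \<open>\<zeta> x z\<close>. These cancel whatever their value, which is why \<open>c\<close>
        may be arbitrary on odd pairs.\<close>
      then have "E x z = sign_twist \<rho> E x z"
        using refl P inner by (simp add: convolution_ends [OF xz])
      then show ?thesis
        using False by (simp add: sign_twist_odd)
    qed
    then show ?thesis using False by (simp add: E_def)
  qed
qed

lemma eulerian_if_is_recursive_zeta:
  assumes "is_recursive_zeta P r \<rho> c \<zeta>"
  shows "eulerian_quasi_graded_poset P r \<rho> \<zeta>"
proof unfold_locales
  show "\<zeta> \<in> incidence_algebra r" and "\<And>x. x \<in> P \<Longrightarrow> \<zeta> x x = 1"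
    using assms by (simp_all add: is_recursive_zeta_def)
  show "(\<Sum>y\<in>{y. (x, y) \<in> r \<and> (y, z) \<in> r}. (-1) powi rank_diff \<rho> x y * \<zeta> x y * \<zeta> y z)
      = (if x = z then 1 else 0)" if "(x, z) \<in> r" for x z
    using convolution_twist_zeta [OF assms that]
    by (simp add: convolution_def sign_twist_def)
qed

end

theorem proposition3p2:
  fixes P :: "'a set" and r :: "'a rel" and \<rho> :: "'a \<Rightarrow> nat"
    and c :: "'a \<Rightarrow> 'a \<Rightarrow> complex"
  assumes "finite_ranked_poset P r \<rho>"
  shows "(\<exists>!\<zeta>. is_recursive_zeta P r \<rho> c \<zeta>) \<and>
    (\<forall>\<zeta>. is_recursive_zeta P r \<rho> c \<zeta> \<longrightarrow> eulerian_quasi_graded_poset P r \<rho> \<zeta>)"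
proof -
  interpret finite_ranked_poset P r \<rho> by (fact assms)
  show ?thesis
    using is_recursive_zeta_recursive_zeta is_recursive_zeta_unique eulerian_if_is_recursive_zeta
    by blast
qed

end
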